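(* Let $\bar{\mathcal{G}}=(\bar A,\bar B,\bar S,\bar T)$ be a reduced game of the constrained bi-matrix game $\mathcal{G}=(A,B,S,T)$ (obtained from $t\in\mathbb{R}\setminus\{0\}$ and matrices $U,V,\Sigma$) such that $A=U\bar A V^{\top}$ and $B=U\bar B V^{\top}$. Then the mapping $$(F,G)\mapsto(\mathcal{U}[F],\mathcal{V}[G])$$ is a one-to-one correspondence between $\operatorname{maxNashFaces}\mathcal{G}$ and $\operatorname{maxNashFaces}\bar{\mathcal{G}}$. The inverse map is $$(\bar F,\bar G)\mapsto\bigl(\mathcal{U}^{-1}[\bar F]\cap(S\times\mathbb{R}),\ \mathcal{V}^{-1}[\bar G]\cap(T\times\mathbb{R})\bigr).$$
   Context: A constrained bi-matrix game $\mathcal{G}=(A,B,S,T)$ consists of $A,B\in\mathbb{R}^{m\times n}$ and nonempty convex polytopes $S\subseteq\mathbb{R}^m$, $T\subseteq\mathbb{R}^n$. $\operatorname{Nash}(\mathcal{G})$ is the set of Nash equilibria: pairs $(x,y)\in S\times T$ with $x\in\arg\max_{x'\in S}y^{\top}A^{\top}x'$ and $y\in\arg\max_{y'\in T}x^{\top}By'$. The optimal value functions of $\mathcal{G}$ are $\eta:\mathbb{R}^n\to\mathbb{R}\cup\{\infty\}$, $\eta(y)=\max_{x\in S}y^{\top}A^{\top}x$ if $y\in T$ and $\eta(y)=\infty$ otherwise, and $\xi:\mathbb{R}^m\to\mathbb{R}\cup\{\infty\}$, $\xi(x)=\max_{y\in T}x^{\top}By$ if $x\in S$ and $\xi(x)=\infty$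 otherwise. $\operatorname{epi}$ denotes the epigraph. Reduced game: fix $t\in\mathbb{R}\setminus\{0\}$, let $k=\operatorname{rank}(A+tB)$ and let $A+tB=U\Sigma V^{\top}$ be a singular value decomposition with $U\in\mathbb{R}^{m\times k}$, $V\in\mathbb{R}^{n\times k}$, $U^{\top}U=I_k$, $V^{\top}V=I_k$, and $\Sigma\in\mathbb{R}^{k\times k}$ diagonal containing the $k$ nonzero singular values of $A+tB$. The reduced game is $\bar{\mathcal{G}}=(\bar A,\bar B,\bar S,\bar T)$ with $\bar A=U^{\top}AV$, $\bar B=U^{\top}BV$, $\bar S=U^{\top}[S]$, $\bar T=V^{\top}[T]$; it is itself a constrained bi-matrix game, with optimal value functions $\bar\eta,\bar\xi:\mathbb{R}^k\to\mathbb{R}\cup\{\infty\}$ given by $\bar\eta(y)=\max_{x\in\bar S}y^{\top}\bar A^{\top}x$ if $y\in\bar T$ and $\bar\eta(y)=\infty$ otherwise, and $\bar\xi(x)=\max_{y\in\bar T}x^{\top}\bar By$ if $x\in\bar S$ and $\bar\xi(x)=\infty$ otherwise. Notation: for a matrix $M$, $M[\cdot]$ and $M^{-1}[\cdot]$ denote image and inverse image under the linear map $M$; $\mathcal{U}=\begin{pmatrix}U^{\top}&0\\0&1\end{pmatrix}$, $\mathcal{V}=\begin{pmatrix}V^{\top}&0\\0&1\end{pmatrix}$. A proper face of a convex polyhedron $P$ is the intersection of $P$ with a supporting hyperplane; $\emptyset$ and $P$ are improper faces. A face $F$ of the epigraph $\operatorname{epi}f$ of an extended real-valued function $f$ is non-vertical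 if every point of $F$ is of the form $(x,f(x))$. Polyhedral convex sets $F\subseteq\mathbb{R}^{m+1}$, $G\subseteq\mathbb{R}^{n+1}$ form a pair of Nash faces of $\mathcal{G}$, written $(F,G)\in\operatorname{NashFaces}\mathcal{G}$, if $F$ is a non-vertical face of $\operatorname{epi}\xi$, $G$ is a non-vertical face of $\operatorname{epi}\eta$, and $\{x\mid(x,\xi(x))^{\top}\in F\}\times\{y\mid(y,\eta(y))^{\top}\in G\}\subseteq\operatorname{Nash}(\mathcal{G})$. A pair $(\bar F,\bar G)\in\operatorname{NashFaces}\mathcal{G}$ is maximal, written $(\bar F,\bar G)\in\operatorname{maxNashFaces}\mathcal{G}$, if $(F,G)\in\operatorname{NashFaces}\mathcal{G}$, $F\supseteq\bar F$, $G\supseteq\bar G$ imply $(F,G)=(\bar F,\bar G)$. The same definitions apply to $\bar{\mathcal{G}}$ (with $\bar\xi,\bar\eta$ and $\mathbb{R}^{k+1}$). *)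

theory Defs
  imports "HOL-Analysis.Analysis"
begin

section \<open>Constrained bi-matrix games\<close>

definition constrained_game ::
  "real^'n^'m \<Rightarrow> real^'n^'m \<Rightarrow> (real^'m) set \<Rightarrow> (real^'n) set \<Rightarrow> bool"
  where "constrained_game A B S T \<longleftrightarrow>
    polytope S \<and> S \<noteq> {} \<and> polytope T \<and> T \<noteq> {}"

definition Nash ::
  "real^'n^'m \<Rightarrow> real^'n^'m \<Rightarrow> (real^'m) set \<Rightarrow> (real^'n) set \<Rightarrow> ((real^'m) \<times> (real^'n)) set"
  where "Nash A B S T = {(x, y).
    is_arg_max (\<lambda>x'. y \<bullet> (transpose A *v x')) (\<lambda>x'. x' \<in> S) x \<and>
    is_arg_max (\<lambda>y'. x \<bullet> (B *v y')) (\<lambda>y'. y' \<in> T) y}"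

text \<open>The maxima in the optimal value functions are written as suprema; for a constrained
  game they are attained, see \<open>value_eta_attained\<close> and \<open>value_xi_attained\<close> below.\<close>

definition value_eta ::
  "real^'n^'m \<Rightarrow> (real^'m) set \<Rightarrow> (real^'n) set \<Rightarrow> real^'n \<Rightarrow> ereal"
  where "value_eta A S T y =
    (if y \<in> T then (SUP x\<in>S. ereal (y \<bullet> (transpose A *v x))) else \<infinity>)"

definition value_xi ::
  "real^'n^'m \<Rightarrow> (real^'m) set \<Rightarrow> (real^'n) set \<Rightarrow> real^'m \<Rightarrow> ereal"
  where "value_xi B S T x =
    (if x \<in> S then (SUP y\<in>T. ereal (x \<bullet> (B *v y))) else \<infinity>)"

lemma SUP_linear_attained:
  fixes M :: "real^'a^'b" and C :: "(real^'a) set"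
  assumes "polytope C" "C \<noteq> {}"
  shows "\<exists>c\<in>C. (SUP x\<in>C. ereal (z \<bullet> (M *v x))) = ereal (z \<bullet> (M *v c))
    \<and> (\<forall>x\<in>C. z \<bullet> (M *v x) \<le> z \<bullet> (M *v c))"
proof -
  have "continuous_on C (\<lambda>x. z \<bullet> (M *v x))"
    by (intro continuous_intros linear_continuous_on)
       (simp add: linear_conv_bounded_linear[symmetric])
  then obtain c where c: "c \<in> C" "\<forall>x\<in>C. z \<bullet> (M *v x) \<le> z \<bullet> (M *v c)"
    using continuous_attains_sup[of C "\<lambda>x. z \<bullet> (M *v x)"] assms polytope_imp_compact
    by blast
  then have "(SUP x\<in>C. ereal (z \<bullet> (M *v x))) = ereal (z \<bullet> (M *v c))"
    by (intro antisym SUP_least SUP_upper) auto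
  then show ?thesis using c by blast
qed

lemma value_eta_attained:
  assumes "constrained_game A B S T" "y \<in> T"
  shows "\<exists>x\<in>S. value_eta A S T y = ereal (y \<bullet> (transpose A *v x))
    \<and> (\<forall>x'\<in>S. y \<bullet> (transpose A *v x') \<le> y \<bullet> (transpose A *v x))"
  using SUP_linear_attained[of S y "transpose A"] assms
  by (simp add: constrained_game_def value_eta_def)

lemma value_xi_attained:
  assumes "constrained_game A B S T" "x \<in> S"
  shows "\<exists>y\<in>T. value_xi B S T x = ereal (x \<bullet> (B *v y))
    \<and> (\<forall>y'\<in>T. x \<bullet> (B *v y') \<le> x \<bullet> (B *v y))"
  using SUP_linear_attained[of T x B] assms
  by (simp add: constrained_game_def value_xi_def)

section \<open>Nash faces\<close>

text \<open>The space of dimension \<open>d + 1\<close> containing an epigraph is the product of the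
  \<open>d\<close>-dimensional space with the reals.\<close>

definition epi :: "('a \<Rightarrow> ereal) \<Rightarrow> ('a \<times> real) set"
  where "epi f = {(x, r). f x \<le> ereal r}"

text \<open>Faces are the library's exposed faces: by lemma \<open>exposed_face_of\<close> these are, for convex
  \<open>P\<close>, the empty set, \<open>P\<close> itself and the intersections of \<open>P\<close> with supporting hyperplanes.\<close>

definition nonvertical_face :: "('a::euclidean_space \<times> real) set \<Rightarrow> ('a \<Rightarrow> ereal) \<Rightarrow> bool"
  where "nonvertical_face F f \<longleftrightarrow>
    F exposed_face_of epi f \<and> (\<forall>(x, r)\<in>F. f x = ereal r)"

definition graph_points :: "('a \<Rightarrow> ereal) \<Rightarrow> ('a \<times> real) set \<Rightarrow> 'a set"
  where "graph_points f F = {x. \<exists>r. f x = ereal r \<and> (x, r) \<in> F}"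

definition NashFaces ::
  "real^'n^'m \<Rightarrow> real^'n^'m \<Rightarrow> (real^'m) set \<Rightarrow> (real^'n) set
    \<Rightarrow> (((real^'m) \<times> real) set \<times> ((real^'n) \<times> real) set) set"
  where "NashFaces A B S T = {(F, G).
    polyhedron F \<and> polyhedron G \<and>
    nonvertical_face F (value_xi B S T) \<and>
    nonvertical_face G (value_eta A S T) \<and>
    graph_points (value_xi B S T) F \<times> graph_points (value_eta A S T) G \<subseteq> Nash A B S T}"

definition maxNashFaces ::
  "real^'n^'m \<Rightarrow> real^'n^'m \<Rightarrow> (real^'m) set \<Rightarrow> (real^'n) set
    \<Rightarrow> (((real^'m) \<times> real) set \<times> ((real^'n) \<times> real) set) set"
  where "maxNashFaces A B S T = {(F0, G0).
    (F0, G0) \<in> NashFaces A B S T \<and>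
    (\<forall>F G. (F, G) \<in> NashFaces A B S T \<and> F \<supseteq> F0 \<and> G \<supseteq> G0 \<longrightarrow> (F, G) = (F0, G0))}"

section \<open>Reduced games\<close>

text \<open>The rank \<open>k\<close> may be 0 (if \<open>A + tB = 0\<close>), while index types are nonempty. Therefore the
  \<open>k\<close> coordinates are indexed by a set \<open>K\<close> of cardinality \<open>k\<close> in a finite type \<open>'k\<close>, and
  \<open>k\<close>-dimensional space is the coordinate subspace of \<open>real^'k\<close> on which all coordinates outside
  \<open>K\<close> vanish. For \<open>K = UNIV\<close> this is \<open>real^'k\<close> with \<open>CARD('k) = k\<close>; for \<open>K = {}\<close> it is the
  zero space. Matrices with an index in \<open>K\<close> are padded by zeros outside \<open>K\<close>. In particular
  \<open>id_on K\<close> is the identity matrix of size \<open>k\<close>, and \<open>transpose U ** U = id_on K\<close> says that the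
  columns of \<open>U\<close> in \<open>K\<close> are orthonormal and the others are zero. A padded game has the same
  strategies, value functions, epigraphs (they are infinite outside the strategy sets) and
  faces as the original one.\<close>

definition id_on :: "'k set \<Rightarrow> real^'k^'k"
  where "id_on K = (\<chi> i j. if i = j \<and> i \<in> K then 1 else 0)"

text \<open>Singular value decomposition restricted to the nonzero (hence positive) singular values.
  No ordering of the singular values is imposed.\<close>

definition compact_svd ::
  "'k set \<Rightarrow> real^'n^'m \<Rightarrow> real^'k^'m \<Rightarrow> real^'k^'k \<Rightarrow> real^'k^'n \<Rightarrow> bool"
  where "compact_svd K M U \<Sigma> V \<longleftrightarrow>
    card K = rank M \<and>
    transpose U ** U = id_on K \<and>
    transpose V ** V = id_on K \<and>
    (\<forall>i j. i \<noteq> j \<longrightarrow> \<Sigma> $ i $ j = 0) \<and>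
    (\<forall>i\<in>K. \<Sigma> $ i $ i > 0) \<and>
    (\<forall>i. i \<notin> K \<longrightarrow> \<Sigma> $ i $ i = 0) \<and>
    M = U ** \<Sigma> ** transpose V"

definition reduced_matrix :: "real^'k^'m \<Rightarrow> real^'k^'n \<Rightarrow> real^'n^'m \<Rightarrow> real^'k^'k"
  where "reduced_matrix U V M = transpose U ** M ** V"

definition reduced_set :: "real^'k^'m \<Rightarrow> (real^'m) set \<Rightarrow> (real^'k) set"
  where "reduced_set U S = (\<lambda>x. transpose U *v x) ` S"

text \<open>The linear map with block diagonal matrix \<open>diag (transpose U, 1)\<close>.\<close>

definition ext_map :: "real^'k^'m \<Rightarrow> (real^'m) \<times> real \<Rightarrow> (real^'k) \<times> real"
  where "ext_map U = (\<lambda>(x, r). (transpose U *v x, r))"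

end

theory Submission
  imports Defs
begin

text \<open>The pullback of faces along the reduction is monotone, preserves Nash faces, and is a right
  inverse of the image map. Conversely every pair of Nash faces is contained in a pulled-back one,
  and these facts together put the maximal pairs into correspondence. For the containment, if both
  faces are nonempty, replace each by the set of common equilibrium partners of the other: whether
  \<open>(x, y)\<close> is an equilibrium depends only on its projection, and the partners of a fixed strategy
  form an exposed face. If one face is empty, the other one is contained in the set on which a single
  opposing strategy is optimal, which is again a pullback.\<close>

section \<open>Factorized payoffs and exchange of the two players\<close>

lemma transpose_mult_mult:
  fixes U :: "real^'k^'m" and M :: "real^'k^'k" and V :: "real^'k^'n"
  shows "transpose (U ** M ** transpose V) = V ** transpose M ** transpose U"
  by (simp add: matrix_transpose_mul matrix_mul_assoc)

text \<open>Payoffs see the strategies only through their projections. Every transfer between the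
  game and the reduced game rests on this.\<close>

lemma inner_factorized:
  fixes U :: "real^'k^'m" and M :: "real^'k^'k" and V :: "real^'k^'n"
  shows "x \<bullet> ((U ** M ** transpose V) *v y) = (transpose U *v x) \<bullet> (M *v (transpose V *v y))"
  by (simp add: transpose_matrix_vector dot_lmul_matrix flip: matrix_vector_mul_assoc)

lemma constrained_game_swap:
  "constrained_game (transpose B) (transpose A) T S \<longleftrightarrow> constrained_game A B S T"
  by (auto simp: constrained_game_def)

text \<open>Allows everything about faces to be proved for \<open>value_xi\<close> alone: the other
  player is covered by transposing the matrices and exchanging the strategy sets. By
  \<open>transpose_mult_mult\<close> a factorized game stays factorized under this exchange.\<close>

lemma value_eta_conv_xi: "value_eta A S T = value_xi (transpose A) T S"
  by (simp add: value_eta_def value_xi_def fun_eq_iff)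

lemma Nash_iff:
  "(x, y) \<in> Nash A B S T \<longleftrightarrow> x \<in> S \<and> y \<in> T \<and>
    (\<forall>x'\<in>S. y \<bullet> (transpose A *v x') \<le> y \<bullet> (transpose A *v x)) \<and>
    (\<forall>y'\<in>T. x \<bullet> (B *v y') \<le> x \<bullet> (B *v y))"
  by (auto simp: Nash_def is_arg_max_linorder)

lemma Nash_swap: "(y, x) \<in> Nash (transpose B) (transpose A) T S \<longleftrightarrow> (x, y) \<in> Nash A B S T"
  by (auto simp: Nash_iff)

lemma NashFaces_swap:
  "(G, F) \<in> NashFaces (transpose B) (transpose A) T S \<longleftrightarrow> (F, G) \<in> NashFaces A B S T"
proof -
  have "P \<times> Q \<subseteq> Nash A B S T \<longleftrightarrow> Q \<times> P \<subseteq> Nash (transpose B) (transpose A) T S" for P Q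
    using Nash_swap[of _ _ B A T S] by blast
  then show ?thesis
    by (auto simp: NashFaces_def value_eta_conv_xi)
qed

text \<open>Non-verticality already forces the last coordinate to be the function value, so graph
  points reduce to a plain projection.\<close>

lemma graph_points_eq: "nonvertical_face F f \<Longrightarrow> graph_points f F = fst ` F"
  by (force simp: nonvertical_face_def graph_points_def)

lemma NashFaces_iff:
  "(F, G) \<in> NashFaces A B S T \<longleftrightarrow> polyhedron F \<and> polyhedron G \<and>
    nonvertical_face F (value_xi B S T) \<and> nonvertical_face G (value_eta A S T) \<and>
    fst ` F \<times> fst ` G \<subseteq> Nash A B S T"
  by (simp add: NashFaces_def graph_points_eq cong: conj_cong)

section \<open>Polyhedrality of the epigraphs and their faces\<close>

lemma epi_value_xi:
  assumes "T \<noteq> {}"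
  shows "(x, r) \<in> epi (value_xi B S T) \<longleftrightarrow> x \<in> S \<and> (\<forall>y\<in>T. x \<bullet> (B *v y) \<le> r)"
  by (auto simp: epi_def value_xi_def SUP_le_iff)

lemma polyhedron_Times_UNIV:
  fixes S :: "'a::euclidean_space set"
  assumes "polyhedron S"
  shows "polyhedron (S \<times> (UNIV :: 'b::euclidean_space set))"
proof -
  obtain H where H: "finite H" "S = \<Inter> H" "\<And>h. h \<in> H \<Longrightarrow> \<exists>a b. h = {x. a \<bullet> x \<le> b}"
    using assms unfolding polyhedron_def by metis
  have "S \<times> UNIV = \<Inter> ((\<lambda>h. h \<times> (UNIV :: 'b set)) ` H)"
    using H(2) by auto
  moreover have "polyhedron (h \<times> (UNIV :: 'b set))" if "h \<in> H" for h
  proof -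
    obtain a b where "h = {x. a \<bullet> x \<le> b}"
      using H(3)[OF \<open>h \<in> H\<close>] by blast
    then have "h \<times> (UNIV :: 'b set) = {z. (a, 0) \<bullet> z \<le> b}"
      by auto
    then show ?thesis
      by (simp only: polyhedron_halfspace_le)
  qed
  ultimately show ?thesis
    using H(1) by (auto intro!: polyhedron_Inter)
qed

text \<open>A linear functional is bounded by \<open>r\<close> on a convex hull iff it is at the
  generators. Hence the epigraph is \<open>S \<times> UNIV\<close> cut by finitely many half-spaces,
  one for each point spanning \<open>T\<close>.\<close>

lemma polyhedron_epi_value_xi:
  fixes B :: "real^'n^'m"
  assumes "polytope S" "polytope T" "T \<noteq> {}"
  shows "polyhedron (epi (value_xi B S T))"
proof -
  obtain W where W: "finite W" "T = convex hull W"
    using assms by (auto simp: polytope_def)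
  define H where "H = (\<lambda>y. {z :: (real^'m) \<times> real. (B *v y, -1) \<bullet> z \<le> 0})"
  have hull: "(\<forall>y\<in>T. x \<bullet> (B *v y) \<le> r) \<longleftrightarrow> (\<forall>y\<in>W. x \<bullet> (B *v y) \<le> r)" for x r
  proof
    assume *: "\<forall>y\<in>W. x \<bullet> (B *v y) \<le> r"
    have "T \<subseteq> {y. (transpose B *v x) \<bullet> y \<le> r}"
      unfolding W(2)
    proof (rule hull_minimal)
      show "W \<subseteq> {y. (transpose B *v x) \<bullet> y \<le> r}"
        using * by (auto simp: transpose_matrix_vector dot_lmul_matrix)
    qed (rule convex_halfspace_le)
    then show "\<forall>y\<in>T. x \<bullet> (B *v y) \<le> r"
      by (auto simp: transpose_matrix_vector dot_lmul_matrix)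
  qed (auto simp: W(2) hull_inc)
  have "epi (value_xi B S T) = S \<times> UNIV \<inter> \<Inter> (H ` W)"
    using hull by (simp add: set_eq_iff split_paired_all epi_value_xi[OF assms(3)] H_def inner_commute)
  moreover have "polyhedron (S \<times> (UNIV :: real set))"
    using assms by (simp add: polyhedron_Times_UNIV polytope_imp_polyhedron)
  moreover have "polyhedron (\<Inter> (H ` W))"
    using W(1) by (intro polyhedron_Inter) (auto simp: H_def polyhedron_halfspace_le)
  ultimately show ?thesis
    by simp
qed

text \<open>Faces of a polyhedron are polyhedra; this discharges the polyhedrality clauses of
  \<open>NashFaces\<close>.\<close>

lemma nonvertical_face_polyhedron:
  fixes B :: "real^'n^'m"
  assumes "polytope S" "polytope T" "T \<noteq> {}" "nonvertical_face F (value_xi B S T)"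
  shows "polyhedron F"
  using assms polyhedron_epi_value_xi face_of_polyhedron_polyhedron
  by (metis exposed_face_of_def nonvertical_face_def)

section \<open>Non-vertical faces on which one strategy is a best response\<close>

lemma nonvertical_faceI:
  fixes B :: "real^'n^'m"
  assumes "polytope S" "polytope T" "T \<noteq> {}"
    and "\<And>z. z \<in> epi (value_xi B S T) \<Longrightarrow> a \<bullet> z \<le> b"
    and "F = epi (value_xi B S T) \<inter> {z. a \<bullet> z = b}"
    and "\<And>x r. (x, r) \<in> F \<Longrightarrow> value_xi B S T x = ereal r"
  shows "nonvertical_face F (value_xi B S T)"
proof -
  have "convex (epi (value_xi B S T))"
    using assms polyhedron_epi_value_xi polyhedron_imp_convex by blast
  then have "F face_of epi (value_xi B S T)"
    unfolding assms(5) using assms(4) by (intro face_of_Int_supporting_hyperplane_le) auto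
  then show ?thesis
    using assms(4-6) unfolding nonvertical_face_def exposed_face_of_def by blast
qed

lemma value_xi_eqI:
  assumes "(x, r) \<in> epi (value_xi B S T)" "y \<in> T" "x \<bullet> (B *v y) = r"
  shows "value_xi B S T x = ereal r"
proof -
  have "x \<in> S" "value_xi B S T x \<le> ereal r"
    using assms(1) by (auto simp: epi_def value_xi_def split: if_splits)
  moreover have "ereal (x \<bullet> (B *v y)) \<le> value_xi B S T x"
    using \<open>x \<in> S\<close> assms(2) by (auto simp: value_xi_def intro: SUP_upper)
  ultimately show ?thesis
    using assms(3) by auto
qed

lemma value_xi_eq_iff:
  assumes "T \<noteq> {}" "y \<in> T" "\<forall>y'\<in>T. x \<bullet> (B *v y') \<le> x \<bullet> (B *v y)" "x \<in> S"
  shows "value_xi B S T x = ereal r \<longleftrightarrow> r = x \<bullet> (B *v y)"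
  using value_xi_eqI[of x "x \<bullet> (B *v y)" B S T y] assms by (auto simp: epi_value_xi)

text \<open>For \<open>y\<close> in \<open>T\<close> this is the part of the graph of
  \<open>value_xi\<close> over those \<open>x\<close> to which \<open>y\<close> is a best
  response.\<close>

definition support_face ::
  "real^'n^'m \<Rightarrow> (real^'m) set \<Rightarrow> (real^'n) set \<Rightarrow> real^'n \<Rightarrow> ((real^'m) \<times> real) set"
  where "support_face B S T y = epi (value_xi B S T) \<inter> {(x, r). x \<bullet> (B *v y) = r}"

lemma nonvertical_face_support_face:
  fixes B :: "real^'n^'m"
  assumes "polytope S" "polytope T" "y \<in> T"
  shows "nonvertical_face (support_face B S T y) (value_xi B S T)"
proof (rule nonvertical_faceI[where a = "(B *v y, -1)" and b = 0])
  show "T \<noteq> {}" using assms by auto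
  then show "(B *v y, -1) \<bullet> z \<le> 0" if "z \<in> epi (value_xi B S T)" for z
    using that assms by (cases z) (auto simp: epi_value_xi inner_commute)
  show "support_face B S T y = epi (value_xi B S T) \<inter> {z. (B *v y, -1) \<bullet> z = 0}"
    by (auto simp: support_face_def inner_commute)
  show "value_xi B S T x = ereal r" if "(x, r) \<in> support_face B S T y" for x r
    using that assms by (auto simp: support_face_def intro: value_xi_eqI)
qed (use assms in auto)

text \<open>A strategy that is optimal at one relative interior point of a nonvertical face is optimal on
  the whole face.\<close>

lemma nonvertical_face_subset_support_face:
  fixes B :: "real^'n^'m"
  assumes "polytope S" "polytope T" "T \<noteq> {}" "nonvertical_face F (value_xi B S T)" "F \<noteq> {}"
  obtains y where "y \<in> T" "F \<subseteq> support_face B S T y"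
proof -
  have "convex F"
    using nonvertical_face_polyhedron[OF assms(1-4)] by (rule polyhedron_imp_convex)
  then obtain x r where xr: "(x, r) \<in> rel_interior F"
    using assms(5) rel_interior_eq_empty[of F] by (cases "rel_interior F = {}") auto
  then have "(x, r) \<in> F"
    using rel_interior_subset by blast
  then have val: "value_xi B S T x = ereal r" and epi: "(x, r) \<in> epi (value_xi B S T)"
    using assms(4) by (auto simp: nonvertical_face_def epi_def)
  have "x \<in> S"
    using epi assms by (simp add: epi_value_xi)
  then obtain y where y: "y \<in> T" "value_xi B S T x = ereal (x \<bullet> (B *v y))"
    using SUP_linear_attained[of T x B] assms by (auto simp: value_xi_def)
  have "support_face B S T y face_of epi (value_xi B S T)"
    using nonvertical_face_support_face[OF assms(1,2) y(1)]
    by (simp add: nonvertical_face_def exposed_face_of_def)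
  moreover have "(x, r) \<in> support_face B S T y"
    using epi val y by (simp add: support_face_def)
  moreover have "F \<subseteq> epi (value_xi B S T)"
    using assms(4) by (simp add: nonvertical_face_def exposed_face_of_def face_of_imp_subset)
  \<comment> \<open>A face of the epigraph that meets the relative interior of a subset of the
    epigraph contains that whole subset.\<close>
  ultimately have "F \<subseteq> support_face B S T y"
    using xr subset_of_face_of by blast
  then show ?thesis
    using that y by blast
qed

section \<open>Faces of common equilibrium partners\<close>

text \<open>The common partners of \<open>Y\<close> are lifted to the graph of
  \<open>value_xi\<close>, so that non-verticality is built in and only exposedness has to be
  shown.\<close>

definition partner_face ::
  "real^'n^'m \<Rightarrow> real^'n^'m \<Rightarrow> (real^'m) set \<Rightarrow> (real^'n) set \<Rightarrow> (real^'n) set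
    \<Rightarrow> ((real^'m) \<times> real) set"
  where "partner_face A B S T Y =
    {(x, r). value_xi B S T x = ereal r \<and> (\<forall>y\<in>Y. (x, y) \<in> Nash A B S T)}"

text \<open>For fixed \<open>y\<close> with best-response value \<open>h\<close>, both summands of
  \<open>(r - x \<bullet> B y) + (h - x \<bullet> A y)\<close> are nonnegative on the epigraph, so the sum vanishes exactly
  at the equilibrium partners of \<open>y\<close>.\<close>

lemma nonvertical_face_partner_face_single:
  fixes A B :: "real^'n^'m"
  assumes game: "constrained_game A B S T" and "y \<in> T"
  shows "nonvertical_face (partner_face A B S T {y}) (value_xi B S T)"
proof -
  obtain x0 where x0: "x0 \<in> S" "\<forall>x\<in>S. y \<bullet> (transpose A *v x) \<le> y \<bullet> (transpose A *v x0)"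
    using value_eta_attained[OF assms] by blast
  define h where "h = y \<bullet> (transpose A *v x0)"
  have poly: "polytope S" "polytope T" "T \<noteq> {}"
    using game by (auto simp: constrained_game_def)
  \<comment> \<open>Since \<open>x v* A\<close> equals \<open>transpose A *v x\<close>, this writes
    the payoff of the first player as a functional of \<open>x\<close> with coefficients
    \<open>A *v y\<close>, the form needed for the normal vector of the hyperplane.\<close>
  have A: "y \<bullet> (x v* A) = x \<bullet> (A *v y)" for x
    by (metis dot_lmul_matrix inner_commute)
  have le: "x \<bullet> (A *v y) \<le> h" "x \<bullet> (B *v y) \<le> r" if "(x, r) \<in> epi (value_xi B S T)" for x r
    using that poly x0 assms(2) by (auto simp: epi_value_xi h_def A)
  have Nash: "(x, y) \<in> Nash A B S T \<and> value_xi B S T x = ereal r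
      \<longleftrightarrow> (x, r) \<in> epi (value_xi B S T) \<and> x \<bullet> (A *v y) = h \<and> x \<bullet> (B *v y) = r" for x r
  proof
    assume L: "(x, y) \<in> Nash A B S T \<and> value_xi B S T x = ereal r"
    then have "x \<in> S" "\<forall>y'\<in>T. x \<bullet> (B *v y') \<le> x \<bullet> (B *v y)" "h \<le> x \<bullet> (A *v y)"
      using x0 by (auto simp: Nash_iff h_def A)
    moreover have epi: "(x, r) \<in> epi (value_xi B S T)"
      using L by (simp add: epi_def)
    moreover have "x \<bullet> (B *v y) = r"
      using value_xi_eq_iff[of T y x B S r] L calculation poly assms(2) by auto
    ultimately show "(x, r) \<in> epi (value_xi B S T) \<and> x \<bullet> (A *v y) = h \<and> x \<bullet> (B *v y) = r"
      using le[of x r] by auto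
  next
    assume R: "(x, r) \<in> epi (value_xi B S T) \<and> x \<bullet> (A *v y) = h \<and> x \<bullet> (B *v y) = r"
    then show "(x, y) \<in> Nash A B S T \<and> value_xi B S T x = ereal r"
      using x0 assms(2) poly value_xi_eqI[of x r B S T y]
      by (auto simp: Nash_iff epi_value_xi h_def A)
  qed
  show ?thesis
  proof (rule nonvertical_faceI[where a = "(A *v y + B *v y, -1)" and b = h])
    fix z assume "z \<in> epi (value_xi B S T)"
    moreover obtain x r where "z = (x, r)"
      by fastforce
    ultimately show "(A *v y + B *v y, -1) \<bullet> z \<le> h"
      using le[of x r] by (simp add: inner_add_right inner_commute[of _ x])
  next
    have "(x, r) \<in> partner_face A B S T {y} \<longleftrightarrow>
      (x, r) \<in> epi (value_xi B S T) \<inter> {z. (A *v y + B *v y, -1) \<bullet> z = h}" for x r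
    proof -
      have "(x, r) \<in> partner_face A B S T {y} \<longleftrightarrow>
        (x, r) \<in> epi (value_xi B S T) \<and> x \<bullet> (A *v y) = h \<and> x \<bullet> (B *v y) = r"
        using Nash[of x r] by (auto simp: partner_face_def)
      also have "\<dots> \<longleftrightarrow> (x, r) \<in> epi (value_xi B S T) \<and> x \<bullet> (A *v y) + x \<bullet> (B *v y) - r = h"
        using le[of x r] by (cases "(x, r) \<in> epi (value_xi B S T)") (simp_all, linarith)
      finally show ?thesis
        by (simp add: inner_add_right inner_commute[of _ x])
    qed
    then show "partner_face A B S T {y} =
      epi (value_xi B S T) \<inter> {z. (A *v y + B *v y, -1) \<bullet> z = h}"
      by (simp add: set_eq_iff split_paired_all)
  qed (use poly in \<open>auto simp: partner_face_def\<close>)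
qed

text \<open>\<open>Y\<close> may be infinite, but exposed faces are closed under arbitrary nonempty
  intersections. An empty \<open>Y\<close> would give the whole graph of \<open>value_xi\<close>,
  which need not be convex.\<close>

lemma nonvertical_face_partner_face:
  fixes A B :: "real^'n^'m"
  assumes game: "constrained_game A B S T" and "Y \<subseteq> T" "Y \<noteq> {}"
  shows "nonvertical_face (partner_face A B S T Y) (value_xi B S T)"
proof -
  have "partner_face A B S T Y = \<Inter> ((\<lambda>y. partner_face A B S T {y}) ` Y)"
    using assms(3) by (auto simp: partner_face_def)
  moreover have "\<Inter> ((\<lambda>y. partner_face A B S T {y}) ` Y) exposed_face_of epi (value_xi B S T)"
    using nonvertical_face_partner_face_single[OF game] assms(2,3)
    by (intro exposed_face_of_Inter) (auto simp: nonvertical_face_def)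
  ultimately show ?thesis
    by (auto simp: nonvertical_face_def partner_face_def)
qed

text \<open>\<open>G\<close> collects the points that pair with all of \<open>F\<close>, so the
  inclusion in \<open>Nash\<close> holds by construction. Nonemptiness of \<open>F\<close> makes
  \<open>G\<close> an intersection over a nonempty family, hence a face.\<close>

lemma NashFaces_partner_faces:
  fixes A B :: "real^'n^'m"
  assumes game: "constrained_game A B S T" and Y: "Y \<subseteq> T" "Y \<noteq> {}"
    and F: "F = partner_face A B S T Y" "F \<noteq> {}"
    and G: "G = partner_face (transpose B) (transpose A) T S (fst ` F)"
  shows "(F, G) \<in> NashFaces A B S T"
proof -
  have poly: "polytope S" "S \<noteq> {}" "polytope T" "T \<noteq> {}"
    using game by (auto simp: constrained_game_def)
  have nvF: "nonvertical_face F (value_xi B S T)"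
    using nonvertical_face_partner_face[OF game Y] F by simp
  have "fst ` F \<subseteq> S"
    using Y by (auto simp: F partner_face_def Nash_iff)
  then have nvG: "nonvertical_face G (value_eta A S T)"
    using nonvertical_face_partner_face[of "transpose B" "transpose A" T S "fst ` F"] game F(2)
    by (simp add: G value_eta_conv_xi constrained_game_swap)
  have "fst ` F \<times> fst ` G \<subseteq> Nash A B S T"
    by (auto simp: G partner_face_def Nash_swap)
  then show ?thesis
    using nvF nvG poly nonvertical_face_polyhedron[of S T F B]
      nonvertical_face_polyhedron[of T S G "transpose A"]
    by (simp add: NashFaces_iff value_eta_conv_xi)
qed

section \<open>Pullback of faces along the reduction\<close>

text \<open>The candidate inverse of the image map. The restriction to \<open>S\<close> removes
  points outside \<open>S\<close> that share their projection with a strategy.\<close>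

definition pullback :: "real^'k^'m \<Rightarrow> (real^'m) set \<Rightarrow> ((real^'k) \<times> real) set \<Rightarrow> ((real^'m) \<times> real) set"
  where "pullback U S F = ext_map U -` F \<inter> S \<times> UNIV"

lemma mem_pullback: "(x, r) \<in> pullback U S F \<longleftrightarrow> x \<in> S \<and> (transpose U *v x, r) \<in> F"
  by (auto simp: pullback_def ext_map_def)

lemma pullback_mono: "F \<subseteq> G \<Longrightarrow> pullback U S F \<subseteq> pullback U S G"
  by (auto simp: pullback_def)

text \<open>Makes \<open>pullback\<close> injective on sets lying over the reduced strategies, as
  Nash faces do by \<open>NashFaces_fst\<close>. Injectivity is what transfers maximality.\<close>

lemma image_pullback:
  assumes "fst ` F \<subseteq> reduced_set U S"
  shows "ext_map U ` pullback U S F = F"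
proof
  show "F \<subseteq> ext_map U ` pullback U S F"
  proof
    fix z assume "z \<in> F"
    then obtain x where "x \<in> S" "z = (transpose U *v x, snd z)"
      using assms by (force simp: reduced_set_def prod_eq_iff)
    then show "z \<in> ext_map U ` pullback U S F"
      using \<open>z \<in> F\<close> by (intro image_eqI[of _ _ "(x, snd z)"]) (auto simp: ext_map_def mem_pullback)
  qed
qed (auto simp: pullback_def)

lemma polytope_reduced_set: "polytope S \<Longrightarrow> polytope (reduced_set U S)"
  unfolding reduced_set_def by (intro polytope_linear_image matrix_vector_mul_linear)

lemma constrained_game_reduced:
  fixes A B :: "real^'n^'m" and Ab Bb :: "real^'k^'k"
  assumes "constrained_game A B S T"
  shows "constrained_game Ab Bb (reduced_set U S) (reduced_set V T)"
  using assms by (auto simp: constrained_game_def polytope_reduced_set) (auto simp: reduced_set_def)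

text \<open>The supremum over \<open>T\<close> depends on \<open>y\<close> only through its
  projection, so it runs over the reduced set. A point outside \<open>S\<close> has value
  \<infinity> on the left, yet may project into \<open>reduced_set U S\<close>; hence the
  restriction to \<open>S\<close>.\<close>

lemma value_xi_factorized:
  fixes U :: "real^'k^'m" and Mb :: "real^'k^'k" and V :: "real^'k^'n"
  assumes "x \<in> S"
  shows "value_xi (U ** Mb ** transpose V) S T x =
    value_xi Mb (reduced_set U S) (reduced_set V T) (transpose U *v x)"
  using assms by (auto simp: value_xi_def reduced_set_def inner_factorized image_image)

lemma epi_factorized:
  fixes U :: "real^'k^'m" and Mb :: "real^'k^'k" and V :: "real^'k^'n"
  shows "epi (value_xi (U ** Mb ** transpose V) S T) =
    pullback U S (epi (value_xi Mb (reduced_set U S) (reduced_set V T)))"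
proof -
  have "(x, r) \<in> epi (value_xi (U ** Mb ** transpose V) S T) \<longleftrightarrow>
    (x, r) \<in> pullback U S (epi (value_xi Mb (reduced_set U S) (reduced_set V T)))" for x r
  proof (cases "x \<in> S")
    case True
    then show ?thesis
      by (simp only: mem_pullback epi_def value_xi_factorized mem_Collect_eq prod.case simp_thms)
  qed (simp add: mem_pullback epi_def value_xi_def)
  then show ?thesis
    by (simp only: set_eq_iff split_paired_All simp_thms)
qed

lemma Nash_factorized:
  fixes U :: "real^'k^'m" and Ab Bb :: "real^'k^'k" and V :: "real^'k^'n"
  shows "(x, y) \<in> Nash (U ** Ab ** transpose V) (U ** Bb ** transpose V) S T \<longleftrightarrow>
    x \<in> S \<and> y \<in> T \<and>
    (transpose U *v x, transpose V *v y) \<in> Nash Ab Bb (reduced_set U S) (reduced_set V T)"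
  by (auto simp: Nash_iff transpose_mult_mult inner_factorized reduced_set_def)

text \<open>The adjoint of \<open>ext_map U\<close> sends a normal vector \<open>(a, c)\<close>
  exposing \<open>F\<close> to \<open>(U *v a, c)\<close>, which exposes the pullback with the same
  bound \<open>b\<close>.\<close>

lemma nonvertical_face_pullback:
  fixes U :: "real^'k^'m" and Mb :: "real^'k^'k" and V :: "real^'k^'n"
  assumes "polytope S" "polytope T" "T \<noteq> {}"
    and F: "nonvertical_face F (value_xi Mb (reduced_set U S) (reduced_set V T))"
  shows "nonvertical_face (pullback U S F) (value_xi (U ** Mb ** transpose V) S T)"
proof -
  let ?e = "epi (value_xi Mb (reduced_set U S) (reduced_set V T))"
  obtain a c b where ab: "?e \<subseteq> {z. (a, c) \<bullet> z \<le> b}" "F = ?e \<inter> {z. (a, c) \<bullet> z = b}"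
    using F unfolding nonvertical_face_def exposed_face_of_def by (metis surj_pair)
  have adj: "(U *v a, c) \<bullet> (x, r) = (a, c) \<bullet> (transpose U *v x, r)" for x r
  proof -
    have "(U *v a) \<bullet> x = a \<bullet> (transpose U *v x)"
      by (metis dot_lmul_matrix inner_commute transpose_matrix_vector)
    then show ?thesis
      by simp
  qed
  show ?thesis
  proof (rule nonvertical_faceI[where a = "(U *v a, c)" and b = b])
    fix z assume "z \<in> epi (value_xi (U ** Mb ** transpose V) S T)"
    then show "(U *v a, c) \<bullet> z \<le> b"
      using ab(1) by (cases z) (auto simp only: epi_factorized mem_pullback adj)
  next
    show "pullback U S F =
      epi (value_xi (U ** Mb ** transpose V) S T) \<inter> {z. (U *v a, c) \<bullet> z = b}"
      using adj by (auto simp: epi_factorized mem_pullback ab(2))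
  next
    fix x r assume "(x, r) \<in> pullback U S F"
    then show "value_xi (U ** Mb ** transpose V) S T x = ereal r"
      using F by (auto simp: mem_pullback value_xi_factorized nonvertical_face_def)
  qed (use assms in auto)
qed

lemma nonvertical_face_fst:
  assumes "nonvertical_face F (value_xi B S T)"
  shows "fst ` F \<subseteq> S"
proof clarify
  fix x r assume "(x, r) \<in> F"
  then have "value_xi B S T x = ereal r"
    using assms by (auto simp: nonvertical_face_def)
  then show "fst (x, r) \<in> S"
    by (auto simp: value_xi_def split: if_splits)
qed

lemma NashFaces_fst:
  assumes "(F, G) \<in> NashFaces A B S T"
  shows "fst ` F \<subseteq> S" "fst ` G \<subseteq> T"
  using assms nonvertical_face_fst[of F B S T] nonvertical_face_fst[of G "transpose A" T S]
  by (simp_all add: NashFaces_iff value_eta_conv_xi)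

lemma NashFaces_pullback:
  fixes U :: "real^'k^'m" and Ab Bb :: "real^'k^'k" and V :: "real^'k^'n"
  assumes game: "constrained_game (U ** Ab ** transpose V) (U ** Bb ** transpose V) S T"
    and FG: "(F, G) \<in> NashFaces Ab Bb (reduced_set U S) (reduced_set V T)"
  shows "(pullback U S F, pullback V T G) \<in>
    NashFaces (U ** Ab ** transpose V) (U ** Bb ** transpose V) S T"
proof -
  have poly: "polytope S" "S \<noteq> {}" "polytope T" "T \<noteq> {}"
    using game by (auto simp: constrained_game_def)
  have nv: "nonvertical_face (pullback U S F) (value_xi (U ** Bb ** transpose V) S T)"
    "nonvertical_face (pullback V T G) (value_xi (transpose (U ** Ab ** transpose V)) T S)"
    using FG poly nonvertical_face_pullback[of S T F Bb U V]
      nonvertical_face_pullback[of T S G "transpose Ab" V U]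
    by (simp_all add: NashFaces_iff value_eta_conv_xi transpose_mult_mult)
  have "fst ` pullback U S F \<times> fst ` pullback V T G \<subseteq>
    Nash (U ** Ab ** transpose V) (U ** Bb ** transpose V) S T"
    using FG by (force simp: NashFaces_iff Nash_factorized mem_pullback)
  then show ?thesis
    using nv nonvertical_face_polyhedron[OF poly(1,3,4) nv(1)]
      nonvertical_face_polyhedron[OF poly(3,1,2) nv(2)]
    by (simp add: NashFaces_iff value_eta_conv_xi)
qed

section \<open>Enlarging Nash faces to pullbacks\<close>

text \<open>Beside an empty face the equilibrium condition is vacuous, so any non-vertical face of
  the reduced epigraph qualifies. The one exposed by the projection of a strategy optimal on all of
  \<open>F\<close> has a large enough pullback.\<close>

lemma empty_face_subset_pullback:
  fixes U :: "real^'k^'m" and Ab Bb :: "real^'k^'k" and V :: "real^'k^'n"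
  assumes game: "constrained_game (U ** Ab ** transpose V) (U ** Bb ** transpose V) S T"
    and F: "nonvertical_face F (value_xi (U ** Bb ** transpose V) S T)" "F \<noteq> {}"
  obtains Fb where "(Fb, {}) \<in> NashFaces Ab Bb (reduced_set U S) (reduced_set V T)"
    "F \<subseteq> pullback U S Fb"
proof -
  have poly: "polytope S" "S \<noteq> {}" "polytope T" "T \<noteq> {}"
    using game by (auto simp: constrained_game_def)
  obtain y where y: "y \<in> T" "F \<subseteq> support_face (U ** Bb ** transpose V) S T y"
    using nonvertical_face_subset_support_face[OF poly(1,3,4) F] .
  let ?S = "reduced_set U S" and ?T = "reduced_set V T" and ?v = "transpose V *v y"
  have poly': "polytope ?S" "polytope ?T" "?v \<in> ?T"
    using poly y by (auto simp: polytope_reduced_set) (auto simp: reduced_set_def)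
  have nv: "nonvertical_face (support_face Bb ?S ?T ?v) (value_xi Bb ?S ?T)"
    by (rule nonvertical_face_support_face[OF poly'])
  have "nonvertical_face {} (value_eta Ab ?S ?T)"
    by (simp add: nonvertical_face_def)
  moreover have "polyhedron (support_face Bb ?S ?T ?v)"
    using poly' nv nonvertical_face_polyhedron by blast
  ultimately have "(support_face Bb ?S ?T ?v, {}) \<in> NashFaces Ab Bb ?S ?T"
    using nv by (simp add: NashFaces_iff)
  moreover have "support_face (U ** Bb ** transpose V) S T y \<subseteq> pullback U S (support_face Bb ?S ?T ?v)"
    by (auto simp: support_face_def epi_factorized mem_pullback inner_factorized)
  ultimately show ?thesis
    using that y(2) by blast
qed

lemma NashFaces_subset_pullback:
  fixes U :: "real^'k^'m" and Ab Bb :: "real^'k^'k" and V :: "real^'k^'n"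
  assumes game: "constrained_game (U ** Ab ** transpose V) (U ** Bb ** transpose V) S T"
    and FG: "(F, G) \<in> NashFaces (U ** Ab ** transpose V) (U ** Bb ** transpose V) S T"
  obtains Fb Gb where "(Fb, Gb) \<in> NashFaces Ab Bb (reduced_set U S) (reduced_set V T)"
    "F \<subseteq> pullback U S Fb" "G \<subseteq> pullback V T Gb"
proof -
  let ?A = "U ** Ab ** transpose V" and ?B = "U ** Bb ** transpose V"
  let ?S = "reduced_set U S" and ?T = "reduced_set V T"
  have nvF: "nonvertical_face F (value_xi ?B S T)"
    and nvG: "nonvertical_face G (value_xi (V ** transpose Ab ** transpose U) T S)"
    and Nash: "fst ` F \<times> fst ` G \<subseteq> Nash ?A ?B S T"
    using FG by (auto simp: NashFaces_iff value_eta_conv_xi transpose_mult_mult)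
  have game': "constrained_game (V ** transpose Bb ** transpose U) (V ** transpose Ab ** transpose U) T S"
    using game by (auto simp: constrained_game_def)
  consider "F = {}" "G = {}" | "F \<noteq> {}" "G = {}" | "F = {}" "G \<noteq> {}" | "F \<noteq> {}" "G \<noteq> {}"
    by blast
  then show ?thesis
  proof cases
    case 1
    moreover have "({}, {}) \<in> NashFaces Ab Bb ?S ?T"
      by (simp add: NashFaces_iff nonvertical_face_def)
    ultimately show ?thesis
      using that by blast
  next
    case 2
    obtain Fb where "(Fb, {}) \<in> NashFaces Ab Bb ?S ?T" "F \<subseteq> pullback U S Fb"
      using empty_face_subset_pullback[OF game nvF 2(1)] .
    then show ?thesis
      using 2 that by blast
  next
    case 3
    \<comment> \<open>Case 2 with the players exchanged; \<open>NashFaces_swap\<close> leads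
      back.\<close>
    obtain Gb where "(Gb, {}) \<in> NashFaces (transpose Bb) (transpose Ab) ?T ?S" "G \<subseteq> pullback V T Gb"
      using empty_face_subset_pullback[OF game' nvG 3(2)] .
    then show ?thesis
      using 3 that NashFaces_swap by blast
  next
    case 4
    \<comment> \<open>Partners are taken twice, starting from the projected strategies of
      \<open>G\<close>: \<open>Fb\<close> holds all reduced partners of \<open>Y\<close>, and
      \<open>Gb\<close> all those of \<open>Fb\<close>.\<close>
    define Y where "Y = (\<lambda>y. transpose V *v y) ` fst ` G"
    define Fb where "Fb = partner_face Ab Bb ?S ?T Y"
    define Gb where "Gb = partner_face (transpose Bb) (transpose Ab) ?T ?S (fst ` Fb)"
    have Nash': "(transpose U *v x, transpose V *v y) \<in> Nash Ab Bb ?S ?T"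
      if "(x, r) \<in> F" "(y, s) \<in> G" for x r y s
      using Nash that by (force simp: Nash_factorized)
    have F: "F \<subseteq> pullback U S Fb"
    proof clarify
      fix x r assume xr: "(x, r) \<in> F"
      then have "x \<in> S" "value_xi ?B S T x = ereal r"
        using nvF nonvertical_face_fst[OF nvF] by (force simp: nonvertical_face_def)+
      then show "(x, r) \<in> pullback U S Fb"
        using Nash'[OF xr]
        by (auto simp: mem_pullback Fb_def partner_face_def value_xi_factorized Y_def)
    qed
    have G: "G \<subseteq> pullback V T Gb"
    proof clarify
      fix y s assume ys: "(y, s) \<in> G"
      then have "y \<in> T" "value_xi (V ** transpose Ab ** transpose U) T S y = ereal s"
        using nvG nonvertical_face_fst[OF nvG] by (force simp: nonvertical_face_def)+
      moreover have "transpose V *v y \<in> Y"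
        using ys by (force simp: Y_def)
      ultimately show "(y, s) \<in> pullback V T Gb"
        by (auto simp: mem_pullback Gb_def partner_face_def value_xi_factorized Nash_swap Fb_def)
    qed
    have "Fb \<noteq> {}"
      using F 4 by (auto simp: pullback_def)
    moreover have "Y \<subseteq> ?T" "Y \<noteq> {}"
      using 4 nonvertical_face_fst[OF nvG] by (auto simp: Y_def reduced_set_def)
    ultimately have "(Fb, Gb) \<in> NashFaces Ab Bb ?S ?T"
      using NashFaces_partner_faces[OF constrained_game_reduced[OF game]] Fb_def Gb_def by blast
    then show ?thesis
      using that F G by blast
  qed
qed

section \<open>Maximal pairs and the correspondence\<close>

text \<open>A Nash pair above the pulled-back one lies below another pullback, that of
  \<open>(Fb, Gb)\<close>. Taking images puts \<open>(F, G)\<close> below \<open>(Fb, Gb)\<close>,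
  and maximality of \<open>(F, G)\<close> collapses the sandwich.\<close>

lemma maxNashFaces_pullback:
  fixes U :: "real^'k^'m" and Ab Bb :: "real^'k^'k" and V :: "real^'k^'n"
  assumes game: "constrained_game (U ** Ab ** transpose V) (U ** Bb ** transpose V) S T"
    and FG: "(F, G) \<in> maxNashFaces Ab Bb (reduced_set U S) (reduced_set V T)"
  shows "(pullback U S F, pullback V T G) \<in>
    maxNashFaces (U ** Ab ** transpose V) (U ** Bb ** transpose V) S T"
proof -
  let ?N = "NashFaces (U ** Ab ** transpose V) (U ** Bb ** transpose V) S T"
  let ?Nb = "NashFaces Ab Bb (reduced_set U S) (reduced_set V T)"
  have N: "(F, G) \<in> ?Nb"
    and max: "\<And>F' G'. (F', G') \<in> ?Nb \<Longrightarrow> F \<subseteq> F' \<Longrightarrow> G \<subseteq> G' \<Longrightarrow> F' = F \<and> G' = G"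
    using FG by (auto simp: maxNashFaces_def)
  have "F' = pullback U S F \<and> G' = pullback V T G"
    if F'G': "(F', G') \<in> ?N" "pullback U S F \<subseteq> F'" "pullback V T G \<subseteq> G'" for F' G'
  proof -
    obtain Fb Gb where b: "(Fb, Gb) \<in> ?Nb" "F' \<subseteq> pullback U S Fb" "G' \<subseteq> pullback V T Gb"
      using NashFaces_subset_pullback[OF game F'G'(1)] .
    have "ext_map U ` pullback U S F \<subseteq> ext_map U ` pullback U S Fb"
      "ext_map V ` pullback V T G \<subseteq> ext_map V ` pullback V T Gb"
      using F'G' b by blast+
    then have "F \<subseteq> Fb" "G \<subseteq> Gb"
      using NashFaces_fst[OF N] NashFaces_fst[OF b(1)] by (simp_all add: image_pullback)
    then have "Fb = F" "Gb = G"
      using max b(1) by blast+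
    then show ?thesis
      using b F'G' by blast
  qed
  then show ?thesis
    using NashFaces_pullback[OF game N] by (auto simp: maxNashFaces_def)
qed

text \<open>Maximality turns the containment in a pullback into equality. The reduced pair is then
  maximal: a larger one has a larger pullback, which must coincide with \<open>(F, G)\<close>, and
  \<open>pullback\<close> is injective here.\<close>

lemma maxNashFaces_obtain_reduced:
  fixes U :: "real^'k^'m" and Ab Bb :: "real^'k^'k" and V :: "real^'k^'n"
  assumes game: "constrained_game (U ** Ab ** transpose V) (U ** Bb ** transpose V) S T"
    and FG: "(F, G) \<in> maxNashFaces (U ** Ab ** transpose V) (U ** Bb ** transpose V) S T"
  obtains Fb Gb where "(Fb, Gb) \<in> maxNashFaces Ab Bb (reduced_set U S) (reduced_set V T)"
    "F = pullback U S Fb" "G = pullback V T Gb"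
proof -
  let ?N = "NashFaces (U ** Ab ** transpose V) (U ** Bb ** transpose V) S T"
  let ?Nb = "NashFaces Ab Bb (reduced_set U S) (reduced_set V T)"
  have N: "(F, G) \<in> ?N"
    and max: "\<And>F' G'. (F', G') \<in> ?N \<Longrightarrow> F \<subseteq> F' \<Longrightarrow> G \<subseteq> G' \<Longrightarrow> F' = F \<and> G' = G"
    using FG by (auto simp: maxNashFaces_def)
  obtain Fb Gb where b: "(Fb, Gb) \<in> ?Nb" "F \<subseteq> pullback U S Fb" "G \<subseteq> pullback V T Gb"
    using NashFaces_subset_pullback[OF game N] .
  have eq: "F = pullback U S Fb" "G = pullback V T Gb"
    using max[OF NashFaces_pullback[OF game b(1)]] b by auto
  have "F' = Fb \<and> G' = Gb" if F'G': "(F', G') \<in> ?Nb" "Fb \<subseteq> F'" "Gb \<subseteq> G'" for F' G'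
  proof -
    have "pullback U S F' = pullback U S Fb" "pullback V T G' = pullback V T Gb"
      using max[OF NashFaces_pullback[OF game F'G'(1)]] F'G' eq by (auto simp: pullback_mono)
    then show ?thesis
      using NashFaces_fst[OF F'G'(1)] NashFaces_fst[OF b(1)] image_pullback by metis
  qed
  then have "(Fb, Gb) \<in> maxNashFaces Ab Bb (reduced_set U S) (reduced_set V T)"
    using b(1) by (auto simp: maxNashFaces_def)
  then show ?thesis
    using that eq by blast
qed

theorem theorem4p8:
  fixes A B :: "real^'n^'m" and S :: "(real^'m) set" and T :: "(real^'n) set"
    and t :: real and K :: "'k::finite set"
    and U :: "real^'k^'m" and \<Sigma> :: "real^'k^'k" and V :: "real^'k^'n"
    and Abar Bbar :: "real^'k^'k" and Sbar Tbar :: "(real^'k) set"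
  assumes "constrained_game A B S T"
    and "t \<noteq> 0"
    and "compact_svd K (A + t *\<^sub>R B) U \<Sigma> V"
    and "Abar = reduced_matrix U V A"
    and "Bbar = reduced_matrix U V B"
    and "Sbar = reduced_set U S"
    and "Tbar = reduced_set V T"
    and "A = U ** Abar ** transpose V"
    and "B = U ** Bbar ** transpose V"
  shows "bij_betw (\<lambda>(F, G). (ext_map U ` F, ext_map V ` G))
           (maxNashFaces A B S T) (maxNashFaces Abar Bbar Sbar Tbar) \<and>
         (\<forall>(Fbar, Gbar) \<in> maxNashFaces Abar Bbar Sbar Tbar.
           (ext_map U -` Fbar \<inter> S \<times> UNIV, ext_map V -` Gbar \<inter> T \<times> UNIV)
             \<in> maxNashFaces A B S T \<and>
           (ext_map U ` (ext_map U -` Fbar \<inter> S \<times> UNIV),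
            ext_map V ` (ext_map V -` Gbar \<inter> T \<times> UNIV)) = (Fbar, Gbar)) \<and>
         (\<forall>(F, G) \<in> maxNashFaces A B S T.
           (ext_map U -` (ext_map U ` F) \<inter> S \<times> UNIV,
            ext_map V -` (ext_map V ` G) \<inter> T \<times> UNIV) = (F, G))"
proof -
  let ?M = "maxNashFaces A B S T" and ?Mb = "maxNashFaces Abar Bbar Sbar Tbar"
  let ?f = "\<lambda>(F, G). (ext_map U ` F, ext_map V ` G)"
  let ?g = "\<lambda>(F, G). (pullback U S F, pullback V T G)"
  have game: "constrained_game (U ** Abar ** transpose V) (U ** Bbar ** transpose V) S T"
    using assms(1) by (simp only: assms(8,9)[symmetric])
  have fg: "?f (?g P) = P" if "P \<in> ?Mb" for P
  proof (cases P)
    case (Pair F G)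
    then have "(F, G) \<in> NashFaces Abar Bbar Sbar Tbar"
      using that by (simp add: maxNashFaces_def)
    then show ?thesis
      using Pair NashFaces_fst[of F G] by (simp add: assms(6,7) image_pullback)
  qed
  have g: "?g P \<in> ?M" if "P \<in> ?Mb" for P
    using maxNashFaces_pullback[OF game, of "fst P" "snd P"] that
    by (simp only: assms(6,7) assms(8,9)[symmetric] prod.collapse case_prod_unfold)
  have surj: "\<exists>P\<in>?Mb. Q = ?g P" if "Q \<in> ?M" for Q
  proof (cases Q)
    case (Pair F G)
    then have "(F, G) \<in> maxNashFaces (U ** Abar ** transpose V) (U ** Bbar ** transpose V) S T"
      using that by (simp only: assms(8,9)[symmetric])
    then obtain Fb Gb where "(Fb, Gb) \<in> maxNashFaces Abar Bbar (reduced_set U S) (reduced_set V T)"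
      "F = pullback U S Fb" "G = pullback V T Gb"
      by (rule maxNashFaces_obtain_reduced[OF game])
    then show ?thesis
      unfolding Pair assms(6,7) by (intro bexI[of _ "(Fb, Gb)"]) simp_all
  qed
  \<comment> \<open>With \<open>Q = ?g P\<close> for a maximal reduced pair \<open>P\<close>,
    \<open>fg\<close> gives \<open>?f Q = P\<close>. Both claims follow without showing directly
    that images of faces are faces.\<close>
  have f: "?f Q \<in> ?Mb" and gf: "?g (?f Q) = Q" if "Q \<in> ?M" for Q
    using surj[OF that] fg by metis+
  have "bij_betw ?f ?M ?Mb"
    by (rule bij_betw_byWitness[where f' = ?g]) (use f g fg gf in blast)+
  moreover have "\<forall>(F, G)\<in>?Mb. ?g (F, G) \<in> ?M \<and> ?f (?g (F, G)) = (F, G)"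
    using g fg by blast
  moreover have "\<forall>(F, G)\<in>?M. ?g (?f (F, G)) = (F, G)"
    using gf by blast
  ultimately show ?thesis
    by (simp add: pullback_def)
qed

end
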